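(* Let $R$ be a ring and let $G$ be a group. If the group ring $RG$ is a $UJ^{\#}$ ring, then $R$ is a $UJ^{\#}$ ring and $G$ is a $2$-group.
   Context: All rings are associative with identity. $RG$ denotes the group ring of $G$ over $R$. For a ring $R$, $J(R)$ is the Jacobson radical and $U(R)$ the group of units. Define $J^{\#}(R)=\{z\in R : z^n\in J(R)\text{ for some } n\ge 1\}$. A ring $R$ is called a $UJ^{\#}$ ring if $U(R)=1+J^{\#}(R)$. For a prime $p$, a group is a $p$-group if each of its elements has finite order which is a power of $p$. *)

theory Defs
  imports "HOL-Library.Poly_Mapping"
begin

text \<open>
  Rings are types of class \<^class>\<open>ring_1\<close>: associative, unital, not necessarily commutative, with
  \<open>0 \<noteq> 1\<close>. A predicate on rings or groups takes the type as an \<open>itself\<close> argument.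
\<close>

definition left_ideal :: "'a::ring_1 set \<Rightarrow> bool" where
  "left_ideal I \<longleftrightarrow>
     0 \<in> I \<and> (\<forall>x\<in>I. \<forall>y\<in>I. x + y \<in> I) \<and> (\<forall>r. \<forall>x\<in>I. r * x \<in> I)"

definition maximal_left_ideal :: "'a::ring_1 set \<Rightarrow> bool" where
  "maximal_left_ideal M \<longleftrightarrow>
     left_ideal M \<and> M \<noteq> UNIV \<and> (\<forall>I. left_ideal I \<and> M \<subseteq> I \<longrightarrow> I = M \<or> I = UNIV)"

definition jacobson_radical :: "'a::ring_1 set" where
  "jacobson_radical = \<Inter>{M. maximal_left_ideal M}"

text \<open>
  The library's \<open>is_unit\<close> is one-sided divisibility in a commutative setting;
  here inverses have to be two-sided.
\<close>

definition ring_units :: "'a::ring_1 set" where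
  "ring_units = {u. \<exists>v. u * v = 1 \<and> v * u = 1}"

definition J_sharp :: "'a::ring_1 set" where
  "J_sharp = {z. \<exists>n\<ge>1. z ^ n \<in> jacobson_radical}"

definition UJ_sharp_ring :: "'a::ring_1 itself \<Rightarrow> bool" where
  "UJ_sharp_ring _ \<longleftrightarrow> (ring_units :: 'a set) = (\<lambda>z. 1 + z) ` J_sharp"

text \<open>
  Groups are types of class \<^class>\<open>group_add\<close>. Despite the additive notation, this class does not
  assume commutativity: \<open>+\<close> is the group operation and \<open>0\<close> the neutral element.
  Consequently \<open>group_multiple n g\<close> is the \<open>n\<close>-th power of \<open>g\<close> in multiplicative notation.
\<close>

definition group_multiple :: "nat \<Rightarrow> 'g::group_add \<Rightarrow> 'g" where
  "group_multiple n g = (((+) g) ^^ n) 0"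

definition has_finite_order :: "'g::group_add \<Rightarrow> nat \<Rightarrow> bool" where
  "has_finite_order g n \<longleftrightarrow>
     0 < n \<and> group_multiple n g = 0 \<and> (\<forall>m. 0 < m \<and> m < n \<longrightarrow> group_multiple m g \<noteq> 0)"

definition p_group :: "nat \<Rightarrow> 'g::group_add itself \<Rightarrow> bool" where
  "p_group p _ \<longleftrightarrow> (\<forall>g::'g. \<exists>k. has_finite_order g (p ^ k))"

text \<open>
  Elements of the group ring are the finitely supported functions from the group to the ring. The
  multiplication on \<^type>\<open>poly_mapping\<close> is the convolution induced by \<open>+\<close> on the index type, so that
  \<open>single g a * single h b = single (g + h) (a * b)\<close>.
\<close>

type_synonym ('r, 'g) group_ring = "'g \<Rightarrow>\<^sub>0 'r"

end

theory Submission
  imports Defs "HOL-Computational_Algebra.Primes"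
begin

text \<open>
  Applied to the unit \<open>-1\<close>, the \<open>UJ\<^sup>#\<close> property of \<open>RG\<close> gives \<open>2 \<in> J(RG)\<close>; applied to \<open>g \<in> G\<close>
  it makes \<open>g - 1\<close> nilpotent modulo \<open>J(RG)\<close>, and since \<open>RG/J(RG)\<close> has characteristic 2, some
  \<open>h = g\<^sup>m\<close>, with \<open>m\<close> a power of 2, satisfies \<open>h - 1 \<in> J(RG)\<close>. Hence, for odd \<open>q\<close>,
  \<open>1 + h + \<dots> + h\<^bsup>q-1\<^esup> \<equiv> q \<equiv> 1\<close> modulo \<open>J(RG)\<close> is a unit. If \<open>h\<close> has infinite order this fails
  for \<open>q = 3\<close>, because an inverse would need infinite support. Otherwise one may assume that \<open>h\<close> has
  odd order \<open>q\<close>, and \<open>(h - 1)(1 + h + \<dots> + h\<^bsup>q-1\<^esup>) = 0\<close> forces \<open>h = 1\<close>. The statement about \<open>R\<close> follows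
  by pushing \<open>J(RG)\<close> along the augmentation \<open>RG \<rightarrow> R\<close>.
\<close>

section \<open>The Jacobson radical\<close>

lemma left_ideal_proper_iff:
  assumes "left_ideal I"
  shows "I \<noteq> UNIV \<longleftrightarrow> 1 \<notin> I"
  using assms unfolding left_ideal_def by (metis UNIV_I UNIV_eq_I mult.right_neutral)

text \<open>Zorn's lemma applies because a union of a nonempty chain of left ideals avoiding 1 is
  again one.\<close>

lemma left_ideal_extends_to_maximal:
  fixes I :: "'a::ring_1 set"
  assumes I: "left_ideal I" "1 \<notin> I"
  obtains M where "maximal_left_ideal M" "I \<subseteq> M"
proof -
  let ?A = "{K. left_ideal K \<and> 1 \<notin> K \<and> I \<subseteq> K}"
  have "\<exists>M\<in>?A. \<forall>X\<in>?A. M \<subseteq> X \<longrightarrow> X = M"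
  proof (rule subset_Zorn_nonempty)
    show "?A \<noteq> {}"
      using I by auto
    fix C assume C: "C \<noteq> {}" "subset.chain ?A C"
    have mem: "left_ideal K" "1 \<notin> K" "I \<subseteq> K" if "K \<in> C" for K
      using C that by (auto simp: subset_chain_def)
    have total: "\<forall>K\<in>C. \<forall>L\<in>C. K \<subseteq> L \<or> L \<subseteq> K"
      using C(2) unfolding subset_chain_def by (rule conjunct2)
    have "x + y \<in> \<Union>C" if xy: "x \<in> \<Union>C" "y \<in> \<Union>C" for x y
    proof -
      obtain K L where KL: "x \<in> K" "K \<in> C" "y \<in> L" "L \<in> C"
        using xy by blast
      then have "K \<subseteq> L \<or> L \<subseteq> K"
        using total by blast
      then show ?thesis
        using KL mem(1)[of K] mem(1)[of L] unfolding left_ideal_def by blast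
    qed
    moreover have "0 \<in> \<Union>C"
      using C(1) mem(1) unfolding left_ideal_def by blast
    moreover have "\<forall>r. \<forall>x\<in>\<Union>C. r * x \<in> \<Union>C"
      using mem(1) unfolding left_ideal_def by blast
    ultimately have "left_ideal (\<Union>C)"
      unfolding left_ideal_def by blast
    then show "\<Union>C \<in> ?A"
      using C(1) mem(2,3) by blast
  qed
  then obtain M where MA: "M \<in> ?A" and max: "\<forall>X\<in>?A. M \<subseteq> X \<longrightarrow> X = M"
    by (rule bexE)
  then have M: "left_ideal M" "1 \<notin> M" "I \<subseteq> M"
    by simp_all
  have "X = M \<or> X = UNIV" if "left_ideal X" "M \<subseteq> X" for X
    using max M(3) that left_ideal_proper_iff[of X] by auto
  then have "maximal_left_ideal M"
    unfolding maximal_left_ideal_def using M(1,2) by blast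
  then show thesis
    using M that by blast
qed

lemma jacobson_radical_left_ideal: "left_ideal jacobson_radical"
  unfolding jacobson_radical_def left_ideal_def maximal_left_ideal_def by auto

lemma jacobson_radical_zero: "0 \<in> jacobson_radical"
  and jacobson_radical_add: "x \<in> jacobson_radical \<Longrightarrow> y \<in> jacobson_radical \<Longrightarrow> x + y \<in> jacobson_radical"
  and jacobson_radical_mult: "x \<in> jacobson_radical \<Longrightarrow> r * x \<in> jacobson_radical"
  using jacobson_radical_left_ideal unfolding left_ideal_def by blast+

lemma jacobson_radical_uminus: "x \<in> jacobson_radical \<Longrightarrow> - x \<in> jacobson_radical"
  using jacobson_radical_mult[of x "-1"] by simp

lemma jacobson_radical_diff:
  "x \<in> jacobson_radical \<Longrightarrow> y \<in> jacobson_radical \<Longrightarrow> x - y \<in> jacobson_radical"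
  using jacobson_radical_add[of x "- y"] jacobson_radical_uminus[of y] by simp

text \<open>The left ideal \<open>M + R x\<close>. It serves twice below: with
  \<open>M = {0}\<close> as a principal left ideal, and with \<open>M\<close> maximal to enlarge it
  by an element outside.\<close>

lemma left_ideal_principal_add:
  fixes M :: "'a::ring_1 set"
  assumes "left_ideal M"
  shows "left_ideal {m + r * x |m r. m \<in> M}"
  unfolding left_ideal_def
proof (intro conjI ballI allI)
  show "0 \<in> {m + r * x |m r. m \<in> M}"
    using assms unfolding left_ideal_def by (force intro: exI[of _ 0])
next
  fix a b assume "a \<in> {m + r * x |m r. m \<in> M}" "b \<in> {m + r * x |m r. m \<in> M}"
  then obtain m r n s where *: "a = m + r * x" "m \<in> M" "b = n + s * x" "n \<in> M"
    by blast
  then have "a + b = (m + n) + (r + s) * x" "m + n \<in> M"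
    using assms by (auto simp: left_ideal_def algebra_simps)
  then show "a + b \<in> {m + r * x |m r. m \<in> M}"
    by blast
next
  fix t a assume "a \<in> {m + r * x |m r. m \<in> M}"
  then obtain m r where *: "a = m + r * x" "m \<in> M"
    by blast
  then have "t * a = t * m + (t * r) * x" "t * m \<in> M"
    using assms by (auto simp: left_ideal_def algebra_simps)
  then show "t * a \<in> {m + r * x |m r. m \<in> M}"
    by blast
qed

text \<open>Trades maximal left ideals for an equation. Without a left inverse,
  \<open>1 - r * x\<close> lies in some maximal left ideal, which also contains \<open>r * x\<close>
  and so 1. Conversely, if \<open>x\<close> is outside a maximal \<open>M\<close>, then
  \<open>M + R x\<close> is everything, which puts some left invertible \<open>1 - r * x\<close>
  into \<open>M\<close>.\<close>

theorem jacobson_radical_iff: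
  fixes x :: "'a::ring_1"
  shows "x \<in> jacobson_radical \<longleftrightarrow> (\<forall>r. \<exists>v. v * (1 - r * x) = 1)"
proof (intro iffI allI)
  fix r assume x: "x \<in> jacobson_radical"
  let ?y = "1 - r * x"
  show "\<exists>v. v * ?y = 1"
  proof (rule ccontr)
    assume "\<nexists>v. v * ?y = 1"
    let ?I = "{m + v * ?y |m v. m \<in> {0}}"
    have I: "left_ideal ?I"
      by (rule left_ideal_principal_add) (simp add: left_ideal_def)
    have "1 \<notin> ?I"
      using \<open>\<nexists>v. v * ?y = 1\<close> by fastforce
    with I obtain M where M: "maximal_left_ideal M" "?I \<subseteq> M"
      by (rule left_ideal_extends_to_maximal)
    then have L: "left_ideal M" "M \<noteq> UNIV"
      by (auto simp: maximal_left_ideal_def)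
    have "0 + 1 * ?y \<in> M"
      using M(2) by blast
    moreover have "r * x \<in> M"
      using jacobson_radical_mult[OF x] M(1) unfolding jacobson_radical_def by blast
    ultimately have "(0 + 1 * ?y) + r * x \<in> M"
      using L(1) unfolding left_ideal_def by blast
    then show False
      using left_ideal_proper_iff[OF L(1)] L(2) by simp
  qed
next
  assume inv: "\<forall>r. \<exists>v. v * (1 - r * x) = 1"
  have "x \<in> M" if M: "maximal_left_ideal M" for M
  proof (rule ccontr)
    assume "x \<notin> M"
    have L: "left_ideal M" "M \<noteq> UNIV"
      using M by (auto simp: maximal_left_ideal_def)
    define I where "I = {m + r * x |m r. m \<in> M}"
    have "left_ideal I"
      unfolding I_def using L(1) by (rule left_ideal_principal_add)
    moreover have "M \<subseteq> I"
      unfolding I_def by (force intro: exI[of _ 0])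
    moreover have "x \<in> I"
      unfolding I_def using L(1) by (force simp: left_ideal_def intro: exI[of _ 1])
    ultimately have "1 \<in> I"
      using M \<open>x \<notin> M\<close> unfolding maximal_left_ideal_def by blast
    then obtain m r where m: "m \<in> M" "1 = m + r * x"
      unfolding I_def by blast
    obtain v where "v * (1 - r * x) = 1"
      using inv by blast
    moreover have "m = 1 - r * x"
      using m(2) by (simp add: eq_diff_eq)
    ultimately have "1 \<in> M"
      using L(1) m(1) unfolding left_ideal_def by metis
    then show False
      using left_ideal_proper_iff[OF L(1)] L(2) by simp
  qed
  then show "x \<in> jacobson_radical"
    unfolding jacobson_radical_def by blast
qed

lemma jacobson_radical_one_minus_unit:
  fixes x :: "'a::ring_1"
  assumes "x \<in> jacobson_radical"
  shows "1 - x \<in> ring_units"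
proof -
  obtain v where v: "v * (1 - x) = 1"
    using assms jacobson_radical_iff[of x] by (metis mult_1)
  \<comment> \<open>The choice \<open>r = - v\<close> is made because \<open>v * (1 - x) = 1\<close>
    says \<open>v = 1 + v * x\<close>; hence \<open>v\<close> itself has a left inverse, and this
    must be \<open>1 - x\<close>.\<close>
  obtain w where w: "w * (1 - (- v) * x) = 1"
    using assms jacobson_radical_iff[of x] by blast
  have "v = 1 - (- v) * x"
    using v by (simp add: algebra_simps)
  then have "w * v = 1"
    using w by simp
  then have "w = 1 - x"
    using v by (metis mult.assoc mult_1 mult.right_neutral)
  with v \<open>w * v = 1\<close> show ?thesis
    unfolding ring_units_def by blast
qed

text \<open>Surjectivity lifts every multiplier \<open>r\<close>, and the left inverse upstairs maps
  to one downstairs.\<close>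

lemma jacobson_radical_hom_image:
  fixes f :: "'a::ring_1 \<Rightarrow> 'b::ring_1"
  assumes "surj f" "f 1 = 1" "\<And>a b. f (a - b) = f a - f b" "\<And>a b. f (a * b) = f a * f b"
    and "x \<in> jacobson_radical"
  shows "f x \<in> jacobson_radical"
  unfolding jacobson_radical_iff
proof
  fix r
  obtain s where "r = f s"
    using \<open>surj f\<close> by blast
  obtain v where "v * (1 - s * x) = 1"
    using assms(5) jacobson_radical_iff by blast
  then have "f v * (1 - r * f x) = 1"
    using assms(2-4) \<open>r = f s\<close> by metis
  then show "\<exists>v. v * (1 - r * f x) = 1" ..
qed

section \<open>Geometric sums and the set \<open>J\<^sup>#\<close>\<close>

text \<open>The library versions of the geometric sum assume commutativity.\<close>

lemma geometric_sum_left: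
  fixes x :: "'a::ring_1"
  shows "(x - 1) * (\<Sum>i<n. x ^ i) = x ^ n - 1"
  by (induction n) (simp_all add: algebra_simps)

lemma geometric_sum_right:
  fixes x :: "'a::ring_1"
  shows "(\<Sum>i<n. x ^ i) * (x - 1) = x ^ n - 1"
  by (induction n) (simp_all add: algebra_simps power_commutes)

text \<open>The geometric sum commutes with \<open>1 - x\<close> and multiplies it to
  \<open>1 - x ^ n\<close>, so it yields an inverse on each side.\<close>

lemma one_minus_unit_of_power:
  fixes x :: "'a::ring_1"
  assumes "1 - x ^ n \<in> ring_units"
  shows "1 - x \<in> ring_units"
proof -
  let ?s = "\<Sum>i<n. x ^ i"
  obtain v where v: "(1 - x ^ n) * v = 1" "v * (1 - x ^ n) = 1"
    using assms unfolding ring_units_def by blast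
  have "(1 - x) * ?s = 1 - x ^ n" "?s * (1 - x) = 1 - x ^ n"
    using geometric_sum_left[of x n] geometric_sum_right[of x n]
    by (metis minus_diff_eq mult_minus_left mult_minus_right)+
  then have r: "(1 - x) * (?s * v) = 1" and l: "(v * ?s) * (1 - x) = 1"
    using v by (simp_all add: mult.assoc flip: mult.assoc[of "1 - x"])
  \<comment> \<open>A left inverse and a right inverse of the same element coincide.\<close>
  have "v * ?s = (v * ?s) * ((1 - x) * (?s * v))"
    using r by simp
  also have "\<dots> = ((v * ?s) * (1 - x)) * (?s * v)"
    by (simp only: mult.assoc)
  finally have "v * ?s = ?s * v"
    using l by simp
  then show ?thesis
    using l r unfolding ring_units_def by auto
qed

lemma one_plus_J_sharp_unit:
  fixes z :: "'a::ring_1"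
  assumes "z \<in> J_sharp"
  shows "1 + z \<in> ring_units"
proof -
  obtain n where "z ^ n \<in> jacobson_radical"
    using assms unfolding J_sharp_def by blast
  then have "(-1) ^ n * z ^ n \<in> jacobson_radical"
    by (rule jacobson_radical_mult)
  then have "(- z) ^ n \<in> jacobson_radical"
    using power_minus[of z n] by simp
  then have "1 - (- z) \<in> ring_units"
    by (rule one_minus_unit_of_power[OF jacobson_radical_one_minus_unit])
  then show ?thesis
    by simp
qed

text \<open>The inclusion of \<open>1 + J_sharp\<close> in the units holds in every ring, so only
  the other one has content.\<close>

lemma UJ_sharp_ring_iff:
  "UJ_sharp_ring TYPE('a::ring_1) \<longleftrightarrow> (\<forall>u\<in>ring_units. u - 1 \<in> (J_sharp :: 'a set))"
proof
  assume "UJ_sharp_ring TYPE('a)"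
  then show "\<forall>u\<in>ring_units. u - 1 \<in> (J_sharp :: 'a set)"
    unfolding UJ_sharp_ring_def by (metis add_diff_cancel_left' imageE)
next
  assume *: "\<forall>u\<in>ring_units. u - 1 \<in> (J_sharp :: 'a set)"
  have "u \<in> (\<lambda>z. 1 + z) ` J_sharp" if "u \<in> ring_units" for u :: 'a
    using * that by (intro image_eqI[of _ _ "u - 1"]) auto
  then show "UJ_sharp_ring TYPE('a)"
    unfolding UJ_sharp_ring_def using one_plus_J_sharp_unit by blast
qed

text \<open>The unit -1 makes a power of -2 lie in the radical. Since 2 is central, that power can
  be split off from \<open>(r * 2) ^ n\<close>, and so \<open>1 - r * 2\<close> is a unit for every
  \<open>r\<close>.\<close>

lemma UJ_sharp_two_in_radical:
  assumes "UJ_sharp_ring TYPE('a::ring_1)"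
  shows "(2 :: 'a) \<in> jacobson_radical"
  unfolding jacobson_radical_iff
proof
  fix r :: 'a
  have "- 1 \<in> (ring_units :: 'a set)"
    unfolding ring_units_def by (intro CollectI exI[of _ "- 1"]) simp
  then have "- 1 - 1 \<in> (J_sharp :: 'a set)"
    using assms UJ_sharp_ring_iff by blast
  then obtain n where n: "(- 2 :: 'a) ^ n \<in> jacobson_radical"
    unfolding J_sharp_def by auto
  have "(r * 2) ^ m = r ^ m * 2 ^ m" for m
  proof (induction m)
    case (Suc m)
    have comm: "2 * y = y * 2" for y :: 'a
      by (simp add: mult_2 mult_2_right)
    have "(r * 2) ^ Suc m = r * (2 * r ^ m) * 2 ^ m"
      using Suc by (simp add: mult.assoc)
    also have "\<dots> = r ^ Suc m * 2 ^ Suc m"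
      by (simp add: comm[of "r ^ m"] mult.assoc)
    finally show ?case .
  qed simp
  moreover have "(2 :: 'a) ^ n = (- 1) ^ n * (- 2) ^ n"
    using power_minus[of "- 2 :: 'a" n] by (simp only: minus_minus)
  ultimately have "(r * 2) ^ n = (r ^ n * (- 1) ^ n) * (- 2) ^ n"
    by (simp only: mult.assoc)
  then have "(r * 2) ^ n \<in> jacobson_radical"
    using n jacobson_radical_mult by metis
  then have "1 - r * 2 \<in> ring_units"
    by (rule one_minus_unit_of_power[OF jacobson_radical_one_minus_unit])
  then show "\<exists>v. v * (1 - r * 2) = 1"
    unfolding ring_units_def by blast
qed

text \<open>The squaring step of the next induction: when \<open>s\<close> is a multiple of 2,
  everything beyond \<open>y * y - 1\<close> is one too.\<close>

lemma square_diff_one_plus: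
  fixes y s :: "'a::ring_1"
  shows "(y - 1 + s) * (y - 1 + s) =
    y * y - 1 + ((1 - y) + (1 - y)) + (s * (y - 1) + (y - 1) * s + s * s)"
  by (simp add: algebra_simps)

text \<open>Frobenius modulo 2, valid without commutativity because only powers of the single
  element \<open>x\<close> occur up to multiples of 2. The error has the form \<open>t * 2\<close>
  so that a left ideal containing 2 absorbs it.\<close>

lemma diff_one_power_two_power:
  fixes x :: "'a::ring_1"
  shows "\<exists>t. (x - 1) ^ (2 ^ k) = x ^ (2 ^ k) - 1 + t * 2"
proof (induction k)
  case 0
  show ?case by (auto intro: exI[of _ 0])
next
  case (Suc k)
  then obtain t where t: "(x - 1) ^ (2 ^ k) = x ^ (2 ^ k) - 1 + t * 2"
    by blast
  let ?y = "x ^ (2 ^ k)"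
  have sq: "a ^ (2 ^ Suc k) = (a ^ (2 ^ k)) * (a ^ (2 ^ k))" for a :: 'a
    by (simp add: mult_2 power_add)
  have "(x - 1) ^ (2 ^ Suc k) = (?y - 1 + t * 2) * (?y - 1 + t * 2)"
    by (simp only: sq t)
  also have "\<dots> = ?y * ?y - 1 + ((1 - ?y) + (1 - ?y)) +
      (t * 2 * (?y - 1) + (?y - 1) * (t * 2) + t * 2 * (t * 2))"
    by (rule square_diff_one_plus)
  \<comment> \<open>Centrality of 2 moves the factor to the right end.\<close>
  also have "t * 2 * (?y - 1) = t * (?y - 1) * 2"
    by (simp only: mult_2 mult_2_right mult.assoc distrib_left distrib_right)
  also have "?y * ?y - 1 + ((1 - ?y) + (1 - ?y)) +
      (t * (?y - 1) * 2 + (?y - 1) * (t * 2) + t * 2 * (t * 2)) =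
      ?y * ?y - 1 + (1 - ?y + t * (?y - 1) + (?y - 1) * t + t * 2 * t) * 2"
    by (simp only: mult_2_right[symmetric] distrib_right mult.assoc add.assoc)
  finally show ?case
    unfolding sq by blast
qed

lemma UJ_sharp_unit_power:
  fixes u :: "'a::ring_1"
  assumes UJ: "UJ_sharp_ring TYPE('a)" and "u \<in> ring_units"
  obtains k where "u ^ (2 ^ k) - 1 \<in> jacobson_radical"
proof -
  obtain n where n: "(u - 1) ^ n \<in> jacobson_radical"
    using assms UJ_sharp_ring_iff unfolding J_sharp_def by blast
  \<comment> \<open>The exponent \<open>n\<close> is enlarged to a power of 2, where the Frobenius
    identity is available.\<close>
  have "n \<le> 2 ^ n"
    using less_exp[of n] by simp
  then have "(u - 1) ^ (2 ^ n) = (u - 1) ^ (2 ^ n - n) * (u - 1) ^ n"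
    by (simp flip: power_add)
  then have "(u - 1) ^ (2 ^ n) \<in> jacobson_radical"
    using n by (simp add: jacobson_radical_mult)
  moreover obtain t where "(u - 1) ^ (2 ^ n) = u ^ (2 ^ n) - 1 + t * 2"
    using diff_one_power_two_power by blast
  ultimately have "u ^ (2 ^ n) - 1 + t * 2 - t * 2 \<in> jacobson_radical"
    using jacobson_radical_mult[OF UJ_sharp_two_in_radical[OF UJ], of t]
    by (metis jacobson_radical_diff)
  then show thesis
    using that by simp
qed

lemma power_diff_one_in_radical:
  fixes h :: "'a::ring_1"
  assumes "h - 1 \<in> jacobson_radical"
  shows "h ^ n - 1 \<in> jacobson_radical"
  using jacobson_radical_mult[OF assms] geometric_sum_right by metis

lemma odd_geometric_sum_unit:
  fixes h :: "'a::ring_1"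
  assumes UJ: "UJ_sharp_ring TYPE('a)" and h: "h - 1 \<in> jacobson_radical" and "odd q"
  shows "(\<Sum>i<q. h ^ i) \<in> ring_units"
proof -
  have sum_J: "1 - (\<Sum>i<2 * m + 1. h ^ i) \<in> jacobson_radical" for m
  proof (induction m)
    case 0
    show ?case by (simp add: jacobson_radical_zero)
  next
    case (Suc m)
    let ?a = "2 * m + 1"
    \<comment> \<open>The two new powers are each 1 modulo the radical; together they contribute 2,
      which lies in it.\<close>
    have "1 - (\<Sum>i<2 * Suc m + 1. h ^ i) =
        (1 - (\<Sum>i<?a. h ^ i)) - ((h ^ ?a - 1) + (h ^ Suc ?a - 1) + 1 * 2)"
      by (simp add: algebra_simps)
    then show ?case
      using Suc power_diff_one_in_radical[OF h] UJ_sharp_two_in_radical[OF UJ]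
      by (metis jacobson_radical_add jacobson_radical_diff jacobson_radical_mult)
  qed
  obtain m where "q = 2 * m + 1"
    using \<open>odd q\<close> by (rule oddE)
  then show ?thesis
    using jacobson_radical_one_minus_unit[OF sum_J[of m]] by (simp add: add.commute)
qed

section \<open>The group ring\<close>

text \<open>Unlike \<open>update_induct\<close>, the step asks for no fresh key, so identities
  additive in \<open>f\<close> reduce to single terms.\<close>

lemma poly_mapping_additive_induct [case_names zero add]:
  fixes f :: "'a \<Rightarrow>\<^sub>0 'b::comm_monoid_add"
  assumes "P 0" "\<And>f k v. P f \<Longrightarrow> P (f + Poly_Mapping.single k v)"
  shows "P f"
proof (induction f rule: Poly_Mapping.update_induct)
  case const
  then show ?case by (rule assms(1))
next
  case (update f k v)
  have "Poly_Mapping.update k v f = f + Poly_Mapping.single k v"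
    using update by (intro poly_mapping_eqI)
      (auto simp: lookup_update lookup_add lookup_single in_keys_iff when_def)
  then show ?case
    using update assms(2) by simp
qed

definition augmentation :: "('g \<Rightarrow>\<^sub>0 'r::comm_monoid_add) \<Rightarrow> 'r" where
  "augmentation f = (\<Sum>k\<in>Poly_Mapping.keys f. Poly_Mapping.lookup f k)"

lemma augmentation_add: "augmentation (f + g) = augmentation f + augmentation g"
  unfolding augmentation_def using setsum_keys_plus_distrib[of "\<lambda>_ x. x"] by simp

lemma augmentation_single: "augmentation (Poly_Mapping.single k v) = v"
  by (simp add: augmentation_def)

lemma augmentation_zero: "augmentation 0 = 0"
  by (simp add: augmentation_def)

lemma augmentation_diff:
  fixes f g :: "'g \<Rightarrow>\<^sub>0 'r::ab_group_add"
  shows "augmentation (f - g) = augmentation f - augmentation g"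
  using augmentation_add[of "f - g" g] by (simp add: eq_diff_eq)

lemma augmentation_mult:
  fixes f g :: "('r::ring_1, 'g::monoid_add) group_ring"
  shows "augmentation (f * g) = augmentation f * augmentation g"
proof (induction f rule: poly_mapping_additive_induct)
  case zero
  show ?case by (simp add: augmentation_zero)
next
  case (add f k v)
  have "augmentation (Poly_Mapping.single k v * g) = v * augmentation g"
    by (induction g rule: poly_mapping_additive_induct)
      (simp_all add: augmentation_zero augmentation_add augmentation_single mult_single distrib_left)
  with add show ?case
    by (simp add: augmentation_add augmentation_single distrib_right)
qed

lemma augmentation_one: "augmentation (1 :: ('r::ring_1, 'g::monoid_add) group_ring) = 1"
  by (metis augmentation_single single_one)

text \<open>Multiplying by a group element translates coefficients; \<open>- k\<close> stands on the
  left because the group may be noncommutative.\<close>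

lemma lookup_single_mult:
  fixes f :: "('r::ring_1, 'g::group_add) group_ring"
  shows "Poly_Mapping.lookup (Poly_Mapping.single k a * f) x = a * Poly_Mapping.lookup f (- k + x)"
  by (induction f rule: poly_mapping_additive_induct)
    (auto simp: lookup_add lookup_single mult_single distrib_left when_def add.assoc[symmetric]
      eq_neg_iff_add_eq_0 minus_add_cancel)

lemma UJ_sharp_coefficient_ring:
  assumes "UJ_sharp_ring TYPE(('r::ring_1, 'g::group_add) group_ring)"
  shows "UJ_sharp_ring TYPE('r)"
  unfolding UJ_sharp_ring_iff
proof
  fix u :: 'r assume "u \<in> ring_units"
  then obtain v where uv: "u * v = 1" "v * u = 1"
    unfolding ring_units_def by blast
  \<comment> \<open>The unit is lifted to a constant of the group ring, which the augmentation sends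
    back to \<open>u\<close>.\<close>
  let ?u = "Poly_Mapping.single (0::'g) u"
  have "?u \<in> ring_units"
    unfolding ring_units_def using uv
    by (auto simp: mult_single intro!: exI[of _ "Poly_Mapping.single 0 v"])
  then have "?u - 1 \<in> J_sharp"
    using assms UJ_sharp_ring_iff by blast
  then obtain n where n: "n \<ge> 1" "(?u - 1) ^ n \<in> jacobson_radical"
    unfolding J_sharp_def by blast
  have "surj (augmentation :: ('r, 'g) group_ring \<Rightarrow> 'r)"
    by (rule surjI[of _ "Poly_Mapping.single 0"]) (rule augmentation_single)
  then have "augmentation ((?u - 1) ^ n) \<in> jacobson_radical"
    by (rule jacobson_radical_hom_image[OF _ _ _ _ n(2)])
      (simp_all add: augmentation_one augmentation_diff augmentation_mult)
  moreover have "augmentation (x ^ n) = augmentation x ^ n" for x :: "('r, 'g) group_ring"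
    by (induction n) (simp_all add: augmentation_one augmentation_mult)
  ultimately show "u - 1 \<in> J_sharp"
    unfolding J_sharp_def using n(1)
    by (auto simp: augmentation_diff augmentation_single augmentation_one)
qed

section \<open>Orders of group elements\<close>

lemma group_multiple_0 [simp]: "group_multiple 0 g = 0"
  and group_multiple_Suc [simp]: "group_multiple (Suc n) g = g + group_multiple n g"
  by (simp_all add: group_multiple_def)

lemma group_multiple_add: "group_multiple (m + n) g = group_multiple m g + group_multiple n g"
  by (induction m) (simp_all add: add.assoc)

lemma group_multiple_eq_0_mult: "group_multiple m g = 0 \<Longrightarrow> group_multiple (n * m) g = 0"
  by (induction n) (simp_all add: group_multiple_add)

lemma single_power:
  "Poly_Mapping.single g (1::'r::ring_1) ^ n = Poly_Mapping.single (group_multiple n g) 1"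
  by (induction n) (simp_all add: mult_single)

lemma single_one_eq_one_iff: "Poly_Mapping.single g (1::'r::ring_1) = 1 \<longleftrightarrow> g = 0"
  by (metis lookup_one lookup_single_eq single_one when_def zero_neq_one)

lemma inj_group_multiple:
  assumes "\<And>n. n > 0 \<Longrightarrow> group_multiple n (g::'g::group_add) \<noteq> 0"
  shows "inj (\<lambda>n. group_multiple n g)"
proof (rule linorder_injI)
  fix m n :: nat assume "m < n"
  then have "group_multiple n g = group_multiple (n - m) g + group_multiple m g"
    by (simp flip: group_multiple_add)
  then show "group_multiple m g \<noteq> group_multiple n g"
    using assms[of "n - m"] \<open>m < n\<close> by (metis add.left_neutral add_right_cancel zero_less_diff)
qed

text \<open>The remainder of \<open>m\<close> modulo the least positive exponent also kills
  \<open>g\<close>, so minimality makes it 0.\<close>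

lemma has_finite_order_dvd:
  fixes g :: "'g::group_add"
  assumes "group_multiple m g = 0" "m > 0"
  obtains n where "has_finite_order g n" "n dvd m"
proof -
  define n where "n = (LEAST n. 0 < n \<and> group_multiple n g = 0)"
  have n: "0 < n" "group_multiple n g = 0"
    using LeastI[of "\<lambda>n. 0 < n \<and> group_multiple n g = 0" m] assms unfolding n_def by auto
  have min: "group_multiple k g \<noteq> 0" if "0 < k" "k < n" for k
    using not_less_Least[of k "\<lambda>n. 0 < n \<and> group_multiple n g = 0"] that unfolding n_def by auto
  have "group_multiple m g = group_multiple (m div n * n) g + group_multiple (m mod n) g"
    by (simp flip: group_multiple_add)
  then have "group_multiple (m mod n) g = 0"
    using assms group_multiple_eq_0_mult[OF n(2)] by simp
  then have "m mod n = 0"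
    using min n(1) by (meson bot_nat_0.not_eq_extremum mod_less_divisor)
  then show thesis
    using that[of n] n min unfolding has_finite_order_def by (simp add: mod_eq_0_iff_dvd)
qed

text \<open>The recurrence makes \<open>c\<close> periodic with period 3.\<close>

lemma three_term_recurrence_zero:
  fixes c :: "nat \<Rightarrow> 'a::ab_group_add"
  assumes rec: "\<And>n. c n + c (n + 1) + c (n + 2) = 0" and "finite {n. c n \<noteq> 0}"
  shows "c n = 0"
proof (rule ccontr)
  assume "c n \<noteq> 0"
  have period: "c (k + 3) = c k" for k
    using rec[of k] rec[of "k + 1"] 
    by (simp add: numeral_3_eq_3 add.commute add.left_commute)
       (metis add.assoc add.commute add_left_cancel)
  have "c (n + 3 * k) = c n" for k
  proof (induction k)
    case (Suc k)
    then show ?case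
      using period[of "n + 3 * k"] by (simp add: ac_simps)
  qed simp
  \<comment> \<open>By periodicity one nonzero value recurs infinitely often, against finite
    support.\<close>
  then have "range (\<lambda>k. n + 3 * k) \<subseteq> {n. c n \<noteq> 0}"
    using \<open>c n \<noteq> 0\<close> by auto
  moreover have "infinite (range (\<lambda>k. n + 3 * k))"
    by (simp add: finite_image_iff inj_def)
  ultimately show False
    using assms(2) finite_subset by blast
qed

text \<open>Along the multiples of \<open>x\<close>, the coefficients of a right inverse obey a
  three-term recurrence. Finite support makes the coefficient at 0 vanish when read forwards and
  equal 1 when read backwards.\<close>

lemma infinite_order_not_unit:
  fixes x :: "'g::group_add"
  assumes inf: "\<And>n. n > 0 \<Longrightarrow> group_multiple n x \<noteq> 0"
  shows "(\<Sum>i<3. Poly_Mapping.single x (1::'r::ring_1) ^ i) \<notin> ring_units"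
proof
  let ?s = "\<Sum>i<3. Poly_Mapping.single x (1::'r) ^ i"
  assume "?s \<in> ring_units"
  then obtain w where w: "?s * w = 1"
    unfolding ring_units_def by blast
  have "?s = 1 + Poly_Mapping.single x 1 + Poly_Mapping.single (x + x) 1"
    by (simp add: numeral_3_eq_3 mult_single)
  then have coeff: "Poly_Mapping.lookup w z + Poly_Mapping.lookup w (- x + z) + Poly_Mapping.lookup w (- (x + x) + z) = (1 when z = 0)" for z
    using arg_cong[OF w, of "\<lambda>f. Poly_Mapping.lookup f z"]
    by (simp add: distrib_right lookup_add lookup_single_mult lookup_one)
  \<comment> \<open>\<open>c\<close> runs through the nonnegative multiples of \<open>x\<close> and
    \<open>d\<close> through the nonpositive ones; both start with the coefficient at 0.\<close>
  define c where "c = (\<lambda>n. Poly_Mapping.lookup w (group_multiple n x))"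
  define d where "d = (\<lambda>n. Poly_Mapping.lookup w (- group_multiple n x))"
  have fin: "finite {n. Poly_Mapping.lookup w (i n) \<noteq> 0}" if "inj i" for i :: "nat \<Rightarrow> 'g"
    using finite_vimageI[OF finite_keys[of w] that] by (simp add: vimage_def in_keys_iff)
  have inj: "inj (\<lambda>n. group_multiple n x)"
    using inf by (rule inj_group_multiple)
  have "c n + c (n + 1) + c (n + 2) = 0" for n
  proof -
    \<comment> \<open>Comparing coefficients at \<open>n + 2\<close> avoids the neutral element, so
      the recurrence is homogeneous from \<open>n = 0\<close> on.\<close>
    have "group_multiple (n + 2) x \<noteq> 0"
      by (rule inf) simp
    moreover have "- (x + x) + (x + (x + group_multiple n x)) = group_multiple n x"
      using minus_add_cancel[of "x + x" "group_multiple n x"] by (simp only: add.assoc)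
    ultimately have "c (n + 2) + c (n + 1) + c n = 0"
      using coeff[of "group_multiple (n + 2) x"] by (simp add: c_def numeral_2_eq_2)
    then show ?thesis
      by (simp only: add.commute add.left_commute)
  qed
  moreover have "finite {n. c n \<noteq> 0}"
    unfolding c_def using inj by (rule fin)
  ultimately have c0: "c 0 = 0"
    by (rule three_term_recurrence_zero)
  have d: "d n + d (n + 1) + d (n + 2) = (1 when n = 0)" for n
  proof -
    have "- x + - group_multiple n x = - group_multiple (n + 1) x"
      "- (x + x) + - group_multiple n x = - group_multiple (n + 2) x"
      using group_multiple_add[of n 1 x] group_multiple_add[of n 2 x]
      by (simp_all only: minus_add[symmetric]) (simp_all add: numeral_2_eq_2)
    moreover have "group_multiple n x = 0 \<longleftrightarrow> n = 0"
      using inf by force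
    ultimately show ?thesis
      using coeff[of "- group_multiple n x"] by (simp add: d_def when_def)
  qed
  \<comment> \<open>The shift by one skips the relation at \<open>n = 0\<close>, the only
    inhomogeneous one; it is used last, to compute \<open>d 0\<close>.\<close>
  have "inj (\<lambda>n. - group_multiple (Suc n) x)"
    using inj unfolding inj_def by (metis neg_equal_iff_equal nat.inject)
  then have "finite {n. d (Suc n) \<noteq> 0}"
    unfolding d_def by (rule fin)
  moreover have "d (Suc n) + d (Suc (n + 1)) + d (Suc (n + 2)) = 0" for n
    using d[of "Suc n"] by simp
  ultimately have "d (Suc n) = 0" for n
    using three_term_recurrence_zero[of "\<lambda>n. d (Suc n)"] by blast
  then have "d 0 = 1"
    using d[of 0] by (simp add: numeral_2_eq_2)
  with c0 show False
    by (simp add: c_def d_def)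
qed

lemma UJ_sharp_group_element:
  fixes g :: "'g::group_add"
  assumes UJ: "UJ_sharp_ring TYPE(('r::ring_1, 'g) group_ring)"
  shows "\<exists>k. group_multiple (2 ^ k) g = 0"
proof -
  define u :: "('r, 'g) group_ring" where "u = Poly_Mapping.single g 1"
  have u_power: "u ^ n = 1 \<longleftrightarrow> group_multiple n g = 0" for n
    by (simp add: u_def single_power single_one_eq_one_iff)
  have "u \<in> ring_units"
    unfolding ring_units_def u_def
    by (intro CollectI exI[of _ "Poly_Mapping.single (- g) 1"]) (simp add: mult_single)
  then obtain k where k: "u ^ (2 ^ k) - 1 \<in> jacobson_radical"
    by (rule UJ_sharp_unit_power[OF UJ])
  have "\<exists>m>0. group_multiple m (group_multiple (2 ^ k) g) = 0"
  proof (rule ccontr)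
    assume "\<not> ?thesis"
    then have "(\<Sum>i<3. Poly_Mapping.single (group_multiple (2 ^ k) g) (1::'r) ^ i) \<notin> ring_units"
      by (intro infinite_order_not_unit) blast
    moreover have "(\<Sum>i<3. (u ^ (2 ^ k)) ^ i) \<in> ring_units"
      using UJ k by (rule odd_geometric_sum_unit) simp
    ultimately show False
      by (simp add: u_def single_power)
  qed
  then obtain m where m: "m > 0" "(u ^ (2 ^ k)) ^ m = 1"
    by (auto simp: u_def single_power single_one_eq_one_iff)
  \<comment> \<open>The 2-part of \<open>m\<close> is moved into the exponent of \<open>h\<close>,
    leaving \<open>h ^ q = 1\<close> with \<open>q\<close> odd.\<close>
  obtain q where q: "m = 2 ^ multiplicity 2 m * q" "odd q"
    using m(1) multiplicity_decompose'[of m 2] by auto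
  define h where "h = (u ^ (2 ^ k)) ^ (2 ^ multiplicity 2 m)"
  have "h - 1 \<in> jacobson_radical"
    unfolding h_def using k by (rule power_diff_one_in_radical)
  then have "(\<Sum>i<q. h ^ i) \<in> ring_units"
    using UJ \<open>odd q\<close> by (intro odd_geometric_sum_unit)
  then obtain v where v: "(\<Sum>i<q. h ^ i) * v = 1"
    unfolding ring_units_def by blast
  have "h ^ q = 1"
    using m(2) q(1) unfolding h_def by (metis power_mult)
  then have "(h - 1) * (\<Sum>i<q. h ^ i) = 0"
    by (simp add: geometric_sum_left)
  \<comment> \<open>The geometric sum is a unit, so it cancels on the right.\<close>
  then have "h - 1 = 0"
    using v by (metis mult.assoc mult.right_neutral mult_zero_left)
  then have "u ^ (2 ^ (k + multiplicity 2 m)) = 1"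
    by (simp add: h_def power_add flip: power_mult)
  then show ?thesis
    using u_power by blast
qed

theorem theorem4p4:
  assumes "UJ_sharp_ring TYPE(('r::ring_1, 'g::group_add) group_ring)"
  shows "UJ_sharp_ring TYPE('r) \<and> p_group 2 TYPE('g)"
proof
  show "UJ_sharp_ring TYPE('r)"
    using assms by (rule UJ_sharp_coefficient_ring)
  show "p_group 2 TYPE('g)"
    unfolding p_group_def
  proof
    fix g :: 'g
    obtain k where "group_multiple (2 ^ k) g = 0"
      using UJ_sharp_group_element[OF assms] by blast
    then obtain n where "has_finite_order g n" "n dvd 2 ^ k"
      by (rule has_finite_order_dvd) simp
    then show "\<exists>k. has_finite_order g (2 ^ k)"
      using divides_primepow_nat[OF two_is_prime_nat, of n k] by blast
  qed
qed

end
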